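(* Let $G$ be a graph. Suppose $G=\bigcup_{i=1}^{m}G'_i\cup \bigcup_{j=1}^{n}G''_j$, $G'_i\cong G'_j$ for all $i,j$, $G''_i\cong G''_j$ for all $i,j$, $G/V(G'_1)/\ldots/V(G'_m)\cong G''_i$, $G/V(G''_1)/\ldots/V(G''_n)\cong G'_i$, $V(G)=\bigcup_{i=1}^{m}V(G'_i)=\bigcup_{j=1}^{n}V(G''_j)$, and $L(G'_i)\cap L(G''_j)=\emptyset$. Then $G$ is isomorphic to the vertex-removing synchronised product (VRSP) of $G/V(G'_1)/\ldots/V(G'_m)$ and $G/V(G''_1)/\ldots/V(G''_n)$.
   Context: Graphs are edge-labelled acyclic directed multigraphs $G$ with vertex set $V(G)$, arc set $A(G)$, a set of label pairs $L(G)$, an incidence map $\mu:A\to V\times V$ giving (tail, head) of each arc, and a labelling $\lambda:A\to L$ assigning to each arc a label pair $(\ell(a),t(a))$ (action name, weight). For a nonempty proper subset $X\subset V(G)$, the contraction $G/X$ replaces $X$ by a new vertex $\tilde{x}$, deletes all arcs with both ends in $X$, and redirects every arc with exactly one end in $X$ to/from $\tilde{x}$, keeping its label. The vertex-removing synchronised product (VRSP) of $G_1$ and $G_2$ starts from the Cartesian product $G_1\,\Box\, G_2$; each pair of synchronising arcs (arcs of $G_1$ and $G_2$ with the same label pair) is replaced by a single diagonal arc, and then vertices (with their out-arcs) are removed one by one if they have level $>0$ in the Cartesian product but level $0$ in what remains. When no arcs of $G_1$ and $G_2$ share a label, the VRSP coincides with the Cartesian product. The graphs are assumed connected.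
   Formalization: Added, as the claim fails without it: each V(G'_i) and V(G''_j) share at most one vertex. Contraction also merges arcs with the same tail, head and label pair; the V(G'_i) are pairwise disjoint, likewise the V(G''_j), as iterated contraction requires. *)

theory Defs
  imports "Graph_Theory.Digraph_Component"
begin

record ('v, 'a, 's, 'w) lgraph =
  dig :: "('v, 'a) pre_digraph"
  lab :: "'a \<Rightarrow> 's \<times> 'w"

abbreviation V :: "('v, 'a, 's, 'w) lgraph \<Rightarrow> 'v set" where
  "V G \<equiv> verts (dig G)"

abbreviation A :: "('v, 'a, 's, 'w) lgraph \<Rightarrow> 'a set" where
  "A G \<equiv> arcs (dig G)"

(* Only the label pairs that occur on arcs: the synchronising arcs of two graphs are
   those whose label pair occurs on an arc of the other graph. *)
definition L :: "('v, 'a, 's, 'w) lgraph \<Rightarrow> ('s \<times> 'w) set" where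
  "L G = lab G ` A G"

(* No finiteness is required; parallel arcs are allowed. *)
definition lgraph :: "('v, 'a, 's, 'w) lgraph \<Rightarrow> bool" where
  "lgraph G \<longleftrightarrow> wf_digraph (dig G) \<and> acyclic (arcs_ends (dig G)) \<and> connected (dig G)"

definition lgraph_iso ::
    "('v, 'a, 's, 'w) lgraph \<Rightarrow> ('u, 'b, 's, 'w) lgraph \<Rightarrow> bool" (infix "\<cong>" 50) where
  "G \<cong> H \<longleftrightarrow> (\<exists>\<phi> \<rho>. bij_betw \<phi> (V G) (V H) \<and> bij_betw \<rho> (A G) (A H) \<and>
     (\<forall>a\<in>A G. tail (dig H) (\<rho> a) = \<phi> (tail (dig G) a) \<and>
              head (dig H) (\<rho> a) = \<phi> (head (dig G) a) \<and>
              lab H (\<rho> a) = lab G a))"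

definition lsubgraph ::
    "('v, 'a, 's, 'w) lgraph \<Rightarrow> ('v, 'a, 's, 'w) lgraph \<Rightarrow> bool" where
  "lsubgraph H G \<longleftrightarrow> subgraph (dig H) (dig G) \<and> (\<forall>a\<in>A H. lab H a = lab G a)"

definition is_union_of ::
    "('v, 'a, 's, 'w) lgraph \<Rightarrow> ('v, 'a, 's, 'w) lgraph set \<Rightarrow> bool" where
  "is_union_of G \<H> \<longleftrightarrow> (\<forall>H\<in>\<H>. lsubgraph H G) \<and>
     V G = (\<Union>H\<in>\<H>. V H) \<and> A G = (\<Union>H\<in>\<H>. A H)"


subsection \<open>Contraction\<close>

(* Arcs with the same tail, head and label pair are merged into one of them. *)
definition merge_parallel :: "('v, 'a, 's, 'w) lgraph \<Rightarrow> ('v, 'a, 's, 'w) lgraph" where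
  "merge_parallel G = G\<lparr>dig := (dig G)\<lparr>arcs :=
     (\<lambda>a. SOME b. b \<in> A G \<and> tail (dig G) b = tail (dig G) a \<and>
                  head (dig G) b = head (dig G) a \<and> lab G b = lab G a) ` A G\<rparr>\<rparr>"

(* The vertex replacing X is represented by a chosen element of X, so that contractions
   can be iterated without changing the type; up to isomorphism the choice does not matter. *)
definition contract_vert :: "'v set \<Rightarrow> 'v" where
  "contract_vert X = (SOME x. x \<in> X)"

(* After the redirection of the arcs between X and its complement, distinct arcs may have
   received the same ends and the same label pair; they count as one arc of the contraction.
   For example, contracting the layers of one factor of a Cartesian product then yields a copy
   of the other factor, provided that no two parallel arcs of that factor have the same
   label pair. *)
definition contract ::
    "('v, 'a, 's, 'w) lgraph \<Rightarrow> 'v set \<Rightarrow> ('v, 'a, 's, 'w) lgraph" (infixl "'/'/" 70) where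
  "G // X = (let f = (\<lambda>v. if v \<in> X then contract_vert X else v) in
     merge_parallel
       \<lparr>dig = \<lparr>verts = insert (contract_vert X) (V G - X),
               arcs = {a \<in> A G. \<not> (tail (dig G) a \<in> X \<and> head (dig G) a \<in> X)},
               tail = f \<circ> tail (dig G),
               head = f \<circ> head (dig G)\<rparr>,
        lab = lab G\<rparr>)"

(* G / V(H 1) / ... / V(H k) *)
definition contract_layers ::
    "('v, 'a, 's, 'w) lgraph \<Rightarrow> (nat \<Rightarrow> ('v, 'a, 's, 'w) lgraph) \<Rightarrow> nat \<Rightarrow> ('v, 'a, 's, 'w) lgraph" where
  "contract_layers G H k = foldl (//) G (map (\<lambda>i. V (H i)) [1..<Suc k])"


subsection \<open>Vertex-removing synchronised product\<close>

datatype ('v1, 'a1, 'v2, 'a2) prod_arc =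
  Arc1 'a1 'v2 | Arc2 'v1 'a2 | Sync 'a1 'a2

fun prod_tail :: "('v1, 'a1, 's, 'w) lgraph \<Rightarrow> ('v2, 'a2, 's, 'w) lgraph \<Rightarrow>
    ('v1, 'a1, 'v2, 'a2) prod_arc \<Rightarrow> 'v1 \<times> 'v2" where
  "prod_tail G H (Arc1 a v) = (tail (dig G) a, v)"
| "prod_tail G H (Arc2 u b) = (u, tail (dig H) b)"
| "prod_tail G H (Sync a b) = (tail (dig G) a, tail (dig H) b)"

fun prod_head :: "('v1, 'a1, 's, 'w) lgraph \<Rightarrow> ('v2, 'a2, 's, 'w) lgraph \<Rightarrow>
    ('v1, 'a1, 'v2, 'a2) prod_arc \<Rightarrow> 'v1 \<times> 'v2" where
  "prod_head G H (Arc1 a v) = (head (dig G) a, v)"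
| "prod_head G H (Arc2 u b) = (u, head (dig H) b)"
| "prod_head G H (Sync a b) = (head (dig G) a, head (dig H) b)"

fun prod_lab :: "('v1, 'a1, 's, 'w) lgraph \<Rightarrow> ('v2, 'a2, 's, 'w) lgraph \<Rightarrow>
    ('v1, 'a1, 'v2, 'a2) prod_arc \<Rightarrow> 's \<times> 'w" where
  "prod_lab G H (Arc1 a v) = lab G a"
| "prod_lab G H (Arc2 u b) = lab H b"
| "prod_lab G H (Sync a b) = lab G a"

definition cartesian_prod :: "('v1, 'a1, 's, 'w) lgraph \<Rightarrow> ('v2, 'a2, 's, 'w) lgraph \<Rightarrow>
    ('v1 \<times> 'v2, ('v1, 'a1, 'v2, 'a2) prod_arc, 's, 'w) lgraph" where
  "cartesian_prod G H =
     \<lparr>dig = \<lparr>verts = V G \<times> V H,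
             arcs = {Arc1 a v | a v. a \<in> A G \<and> v \<in> V H} \<union> {Arc2 u b | u b. u \<in> V G \<and> b \<in> A H},
             tail = prod_tail G H, head = prod_head G H\<rparr>,
      lab = prod_lab G H\<rparr>"

definition intermediate_prod :: "('v1, 'a1, 's, 'w) lgraph \<Rightarrow> ('v2, 'a2, 's, 'w) lgraph \<Rightarrow>
    ('v1 \<times> 'v2, ('v1, 'a1, 'v2, 'a2) prod_arc, 's, 'w) lgraph" where
  "intermediate_prod G H =
     \<lparr>dig = \<lparr>verts = V G \<times> V H,
             arcs = {Arc1 a v | a v. a \<in> A G \<and> v \<in> V H \<and> lab G a \<notin> L H}
                  \<union> {Arc2 u b | u b. u \<in> V G \<and> b \<in> A H \<and> lab H b \<notin> L G}
                  \<union> {Sync a b | a b. a \<in> A G \<and> b \<in> A H \<and> lab G a = lab H b},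
             tail = prod_tail G H, head = prod_head G H\<rparr>,
      lab = prod_lab G H\<rparr>"

(* A vertex has level 0 iff no arc enters it, and level > 0 otherwise. Removing a vertex removes its out-arcs, so x has
   level 0 in what remains iff all arcs of the intermediate product that enter x leave from
   vertices that have been removed before. *)
inductive_set vrsp_removed :: "('v1, 'a1, 's, 'w) lgraph \<Rightarrow> ('v2, 'a2, 's, 'w) lgraph \<Rightarrow>
    ('v1 \<times> 'v2) set"
  for G :: "('v1, 'a1, 's, 'w) lgraph" and H :: "('v2, 'a2, 's, 'w) lgraph" where
  remove: "\<lbrakk>x \<in> V (intermediate_prod G H);
            in_arcs (dig (cartesian_prod G H)) x \<noteq> {};
            \<forall>c \<in> in_arcs (dig (intermediate_prod G H)) x.
              tail (dig (intermediate_prod G H)) c \<in> vrsp_removed G H\<rbrakk>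
           \<Longrightarrow> x \<in> vrsp_removed G H"

definition vrsp :: "('v1, 'a1, 's, 'w) lgraph \<Rightarrow> ('v2, 'a2, 's, 'w) lgraph \<Rightarrow>
    ('v1 \<times> 'v2, ('v1, 'a1, 'v2, 'a2) prod_arc, 's, 'w) lgraph" where
  "vrsp G H = (let P = intermediate_prod G H; R = vrsp_removed G H in
     \<lparr>dig = (dig P)\<lparr>verts := V P - R, arcs := {c \<in> A P. tail (dig P) c \<notin> R}\<rparr>,
      lab = lab P\<rparr>)"

end

theory Submission
  imports Defs
begin

text \<open>
  Write \<open>C\<close> and \<open>D\<close> for the two contractions and \<open>p\<close>, \<open>q\<close> for the projections of \<open>V G\<close> onto
  their vertices. A layer of one family meets a layer of the other in at most one vertex, so \<open>p\<close> is
  injective on each \<open>G''\<^sub>j\<close>; since \<open>G''\<^sub>j\<close> is isomorphic to the finite-vertex graph \<open>C\<close>, it is a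
  bijection onto \<open>V C\<close>. Arcs of \<open>C\<close> are determined by their ends and label pair, hence the same holds
  for \<open>G''\<^sub>j\<close>, and \<open>p\<close> induces an injection from the arcs of \<open>G''\<^sub>j\<close> to those of \<open>C\<close>. There are
  only finitely many arcs of \<open>C\<close> with a given label pair, so counting them label by label shows that
  this injection is onto, even if the arc sets are infinite. Thus \<open>v \<mapsto> (p v, q v)\<close> is an isomorphism
  onto the Cartesian product of \<open>C\<close> and \<open>D\<close>, and this is the VRSP because no labels are shared.
\<close>

subsection \<open>Quotients of labelled graphs\<close>

text \<open>The data that decide whether two arcs are merged once \<open>f\<close> has been applied
  to their ends.\<close>

definition arc_key :: "('v \<Rightarrow> 'u) \<Rightarrow> ('v, 'a, 's, 'w) lgraph \<Rightarrow> 'a \<Rightarrow> 'u \<times> 'u \<times> 's \<times> 'w" where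
  "arc_key f G a = (f (tail (dig G) a), f (head (dig G) a), lab G a)"

definition crossing :: "('v \<Rightarrow> 'u) \<Rightarrow> ('v, 'a, 's, 'w) lgraph \<Rightarrow> 'a set" where
  "crossing f G = {a \<in> A G. f (tail (dig G) a) \<noteq> f (head (dig G) a)}"

text \<open>Parallel arcs remain possible as long as their label pairs differ.\<close>

definition simple :: "('v, 'a, 's, 'w) lgraph \<Rightarrow> bool" where
  "simple G \<longleftrightarrow> inj_on (arc_key id G) (A G)"

text \<open>The arcs of \<open>C\<close> are themselves arcs of \<open>G\<close>, chosen so that
  every key of a crossing arc has a representative. Which ones are chosen, and how many, is left
  open, so the notion does not depend on the choices made in a contraction; uniqueness is expressed
  separately by \<open>simple\<close>.\<close>

definition quotient_by ::
    "('v \<Rightarrow> 'u) \<Rightarrow> ('v, 'a, 's, 'w) lgraph \<Rightarrow> ('u, 'a, 's, 'w) lgraph \<Rightarrow> bool" where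
  "quotient_by f G C \<longleftrightarrow> V C = f ` V G \<and> tail (dig C) = f \<circ> tail (dig G) \<and>
     head (dig C) = f \<circ> head (dig G) \<and> lab C = lab G \<and> A C \<subseteq> crossing f G \<and>
     arc_key f G ` A C = arc_key f G ` crossing f G"

lemma quotient_by_id: "crossing id G = A G \<Longrightarrow> quotient_by id G G"
  by (auto simp: quotient_by_def)

lemma quotient_by_loopless: "quotient_by f G C \<Longrightarrow> crossing id C = A C"
  by (auto simp: quotient_by_def crossing_def)

text \<open>The key along \<open>g \<circ> f\<close> is a function of the key along
  \<open>f\<close>, so passing from an arc to its representative for \<open>f\<close> does not
  change its key along the composite.\<close>

lemma quotient_by_trans:
  assumes "quotient_by f G C" and "quotient_by g C D"
  shows "quotient_by (g \<circ> f) G D"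
proof -
  have key: "arc_key g C a = arc_key (g \<circ> f) G a"
       "arc_key (g \<circ> f) G a = map_prod g (map_prod g id) (arc_key f G a)" for a
    using assms(1) by (auto simp: arc_key_def quotient_by_def)
  have sub: "A C \<subseteq> crossing f G" "A D \<subseteq> crossing g C"
    and img: "arc_key f G ` A C = arc_key f G ` crossing f G"
      "arc_key g C ` A D = arc_key g C ` crossing g C"
    using assms by (auto simp: quotient_by_def)
  have cross: "a \<in> crossing g C \<longleftrightarrow> a \<in> A C \<and> a \<in> crossing (g \<circ> f) G" for a
    using assms(1) sub by (auto simp: quotient_by_def crossing_def)
  have "arc_key (g \<circ> f) G a \<in> arc_key (g \<circ> f) G ` A D" if a: "a \<in> crossing (g \<circ> f) G" for a
  proof -
    have "a \<in> crossing f G"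
      using a by (auto simp: crossing_def)
    then obtain c where c: "c \<in> A C" "arc_key f G c = arc_key f G a"
      using img(1) by (metis imageE image_eqI)
    have "c \<in> crossing (g \<circ> f) G"
      using a c sub(1) by (auto simp: crossing_def arc_key_def)
    then have "arc_key g C c \<in> arc_key g C ` A D"
      using c(1) cross img(2) by auto
    then show ?thesis
      using c(2) key by (auto simp: image_iff)
  qed
  moreover have "A D \<subseteq> crossing (g \<circ> f) G"
    using sub cross by auto
  ultimately show ?thesis
    using assms unfolding quotient_by_def by (auto simp: image_comp comp_assoc)
qed

section \<open>Merging and iterated contraction\<close>

lemma merge_parallel:
  fixes G :: "('v, 'a, 's, 'w) lgraph"
  defines "M \<equiv> merge_parallel G"
  shows "A M \<subseteq> A G" "arc_key id G ` A M = arc_key id G ` A G" "simple M"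
    "V M = V G" "tail (dig M) = tail (dig G)" "head (dig M) = head (dig G)" "lab M = lab G"
proof -
  define r where "r a = (SOME b. b \<in> A G \<and> tail (dig G) b = tail (dig G) a \<and>
    head (dig G) b = head (dig G) a \<and> lab G b = lab G a)" for a
  have r: "r a \<in> A G \<and> arc_key id G (r a) = arc_key id G a" if "a \<in> A G" for a
    using someI[of "\<lambda>b. b \<in> A G \<and> tail (dig G) b = tail (dig G) a \<and>
      head (dig G) b = head (dig G) a \<and> lab G b = lab G a" a] that
    by (simp add: r_def arc_key_def)
  \<comment> \<open>The chosen arc depends on \<open>a\<close> only through its key, hence is the
    same throughout a class; this is what makes the merged graph simple.\<close>
  have rcong: "r a = r b" if "arc_key id G a = arc_key id G b" for a b
    using that by (simp add: r_def arc_key_def)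
  have AM: "A M = r ` A G"
    by (simp add: M_def merge_parallel_def r_def)
  show other: "V M = V G" "tail (dig M) = tail (dig G)" "head (dig M) = head (dig G)" "lab M = lab G"
    by (simp_all add: M_def merge_parallel_def)
  show "A M \<subseteq> A G" "arc_key id G ` A M = arc_key id G ` A G"
    using r by (auto simp: AM image_image)
  have "arc_key id M = arc_key id G"
    by (simp add: arc_key_def other fun_eq_iff)
  then show "simple M"
    unfolding simple_def AM by (auto intro!: inj_onI) (metis r rcong)
qed

definition collapse :: "'v set \<Rightarrow> 'v \<Rightarrow> 'v" where
  "collapse X v = (if v \<in> X then contract_vert X else v)"

lemma contract_vert_in: "X \<noteq> {} \<Longrightarrow> contract_vert X \<in> X"
  unfolding contract_vert_def by (rule some_in_eq[THEN iffD2])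

text \<open>The representative lies in \<open>X\<close> and vertices outside \<open>X\<close> stay
  fixed, so in a loopless graph the arcs that cease to cross are exactly those with both ends in
  \<open>X\<close>, which contraction deletes.\<close>

lemma quotient_by_contract:
  assumes loopless: "crossing id G = A G" and X: "X \<noteq> {}" "X \<subseteq> V G"
  shows "quotient_by (collapse X) G (G // X)" "simple (G // X)"
proof -
  define H where "H = \<lparr>dig = \<lparr>verts = insert (contract_vert X) (V G - X),
       arcs = {a \<in> A G. \<not> (tail (dig G) a \<in> X \<and> head (dig G) a \<in> X)},
       tail = collapse X \<circ> tail (dig G), head = collapse X \<circ> head (dig G)\<rparr>, lab = lab G\<rparr>"
  have GX: "G // X = merge_parallel H"
    by (simp add: contract_def H_def Let_def collapse_def[abs_def])
  have key: "arc_key id H = arc_key (collapse X) G"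
    by (simp add: arc_key_def H_def fun_eq_iff)
  have AH: "A H = crossing (collapse X) G"
    using loopless contract_vert_in[OF X(1)]
    by (auto simp: H_def crossing_def collapse_def split: if_splits)
  have "V H = collapse X ` V G"
    using X by (auto simp: H_def collapse_def image_iff)
  then show "quotient_by (collapse X) G (G // X)"
    using merge_parallel[of H] unfolding quotient_by_def GX key AH by (simp add: H_def)
  show "simple (G // X)"
    unfolding GX by (rule merge_parallel)
qed

text \<open>Induction on the number of layers. The last clause keeps the next layer intact until its
  turn comes. Simplicity comes from the last merging, hence the condition
  \<open>k > 0\<close>.\<close>

lemma contract_layers_quotient:
  assumes loopless: "crossing id G = A G"
    and disj: "disjoint_family_on (\<lambda>i. V (H i)) {1..k}"
    and layer: "\<And>i. i \<in> {1..k} \<Longrightarrow> V (H i) \<noteq> {} \<and> V (H i) \<subseteq> V G"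
  shows "\<exists>f. quotient_by f G (contract_layers G H k) \<and>
     (k > 0 \<longrightarrow> simple (contract_layers G H k)) \<and>
     (\<forall>i\<in>{1..k}. \<forall>v\<in>V (H i). f v = contract_vert (V (H i))) \<and>
     (\<forall>v. v \<notin> (\<Union>i\<in>{1..k}. V (H i)) \<longrightarrow> f v = v)"
  using disj layer
proof (induction k)
  case 0
  then show ?case
    using quotient_by_id[OF loopless] by (auto simp: contract_layers_def intro!: exI[of _ id])
next
  case (Suc k)
  let ?X = "V (H (Suc k))" and ?C = "contract_layers G H k"
  have "disjoint_family_on (\<lambda>i. V (H i)) {1..k}"
    using Suc.prems(1) by (rule disjoint_family_on_mono[rotated]) auto
  then obtain f where f: "quotient_by f G ?C"
    "\<And>i v. i \<in> {1..k} \<Longrightarrow> v \<in> V (H i) \<Longrightarrow> f v = contract_vert (V (H i))"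
    "\<And>v. v \<notin> (\<Union>i\<in>{1..k}. V (H i)) \<Longrightarrow> f v = v"
    using Suc.IH Suc.prems(2) by force
  have step: "contract_layers G H (Suc k) = ?C // ?X"
    by (simp add: contract_layers_def)
  have disj: "V (H i) \<inter> ?X = {}" if "i \<in> {1..k}" for i
    using Suc.prems(1) that by (auto simp: disjoint_family_on_def)
  have fX: "f v = v" if "v \<in> ?X" for v
    using f(3) disj that by blast
  have X: "?X \<noteq> {}" "?X \<subseteq> V G"
    using Suc.prems(2)[of "Suc k"] by auto
  have "?X \<subseteq> V ?C"
    using X(2) fX f(1) by (force simp: quotient_by_def)
  note q = quotient_by_contract[OF quotient_by_loopless[OF f(1)] X(1) this]
  have "(collapse ?X \<circ> f) v = contract_vert (V (H i))" if "i \<in> {1..Suc k}" "v \<in> V (H i)" for i v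
  proof (cases "i = Suc k")
    case True
    then show ?thesis
      using that fX by (simp add: collapse_def)
  next
    case False
    then have i: "i \<in> {1..k}"
      using that by auto
    \<comment> \<open>The vertex replacing an earlier layer lies in that layer, hence outside
      \<open>?X\<close>, and survives the next collapse.\<close>
    then have "contract_vert (V (H i)) \<in> V (H i)"
      using Suc.prems(2)[of i] by (intro contract_vert_in) auto
    then show ?thesis
      using f(2)[OF i that(2)] disj[OF i] by (auto simp: collapse_def)
  qed
  moreover have "(collapse ?X \<circ> f) v = v" if "v \<notin> (\<Union>i\<in>{1..Suc k}. V (H i))" for v
  proof -
    have "v \<notin> (\<Union>i\<in>{1..k}. V (H i))" "v \<notin> ?X"
      using that by force+
    then show ?thesis
      using f(3) by (simp add: collapse_def)
  qed
  ultimately show ?case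
    unfolding step using quotient_by_trans[OF f(1) q(1)] q(2) by blast
qed

subsection \<open>Projecting a transversal family of layers\<close>

text \<open>One half of the product structure: \<open>p\<close> contracts the layers
  \<open>H i\<close>, which are its fibres by \<open>p_eq_iff\<close>, and is to identify each
  \<open>K j\<close> with \<open>C\<close>. Exchanging the two families gives the other
  half.\<close>

locale transversal_layers =
  fixes G :: "('v, 'a, 's, 'w) lgraph"
    and H :: "'i \<Rightarrow> ('v, 'a, 's, 'w) lgraph" and I :: "'i set"
    and K :: "'j \<Rightarrow> ('v, 'a, 's, 'w) lgraph" and J :: "'j set"
    and C :: "('u, 'a, 's, 'w) lgraph" and p :: "'v \<Rightarrow> 'u"
  assumes loopless: "crossing id G = A G"
    and subgraph_H: "i \<in> I \<Longrightarrow> lsubgraph (H i) G"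
    and subgraph_K: "j \<in> J \<Longrightarrow> lsubgraph (K j) G"
    and arcs_G: "A G = (\<Union>i\<in>I. A (H i)) \<union> (\<Union>j\<in>J. A (K j))"
    and verts_G: "V G = (\<Union>i\<in>I. V (H i))"
    and disjoint: "disjoint_family_on (\<lambda>i. V (H i)) I"
    and meet: "i \<in> I \<Longrightarrow> j \<in> J \<Longrightarrow> u \<in> V (H i) \<inter> V (K j) \<Longrightarrow> v \<in> V (H i) \<inter> V (K j) \<Longrightarrow> u = v"
    and p_eq_iff: "i \<in> I \<Longrightarrow> u \<in> V (H i) \<Longrightarrow> v \<in> V G \<Longrightarrow> p u = p v \<longleftrightarrow> v \<in> V (H i)"
    and quotient: "quotient_by p G C"
    and simple: "simple C"
    and finite: "finite (V C)"
    and iso: "j \<in> J \<Longrightarrow> C \<cong> K j"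
begin

lemma lsubgraph_arc:
  assumes "lsubgraph S G" "a \<in> A S"
  shows "a \<in> A G" "tail (dig G) a \<in> V S" "head (dig G) a \<in> V S" "lab S a = lab G a"
    "tail (dig S) a = tail (dig G) a" "head (dig S) a = head (dig G) a"
proof -
  have s: "subgraph (dig S) (dig G)" and "lab S a = lab G a"
    using assms by (auto simp: lsubgraph_def)
  interpret wf_digraph "dig S"
    using s by (auto simp: subgraph_def)
  have "compatible (dig G) (dig S)"
    using s by (auto simp: subgraph_def)
  then show "tail (dig S) a = tail (dig G) a" "head (dig S) a = head (dig G) a"
    by (auto simp: compatible_def)
  then show "tail (dig G) a \<in> V S" "head (dig G) a \<in> V S"
    using assms(2) tail_in_verts head_in_verts by metis+
  show "a \<in> A G" "lab S a = lab G a"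
    using s assms by (auto simp: subgraph_def lsubgraph_def)
qed

lemma lsubgraph_verts: "lsubgraph S G \<Longrightarrow> V S \<subseteq> V G"
  by (auto simp: lsubgraph_def subgraph_def)

text \<open>Equal images put both vertices into one layer \<open>H i\<close>, which meets
  \<open>K j\<close> at most once.\<close>

lemma inj_on_p: "j \<in> J \<Longrightarrow> inj_on p (V (K j))"
proof (rule inj_onI)
  fix u v assume j: "j \<in> J" and uv: "u \<in> V (K j)" "v \<in> V (K j)" "p u = p v"
  have "u \<in> V G" "v \<in> V G"
    using uv lsubgraph_verts[OF subgraph_K[OF j]] by auto
  then show "u = v"
    using uv j meet p_eq_iff verts_G by blast
qed

text \<open>An injection into a finite set of the same cardinality is onto; the isomorphism with
  \<open>C\<close> serves here only to compare cardinalities.\<close>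

lemma image_p: "j \<in> J \<Longrightarrow> p ` V (K j) = V C"
proof -
  assume j: "j \<in> J"
  obtain \<phi> where "bij_betw \<phi> (V C) (V (K j))"
    using iso[OF j] by (auto simp: lgraph_iso_def)
  then have "card (p ` V (K j)) = card (V C)"
    using card_image[OF inj_on_p[OF j]] bij_betw_same_card by metis
  moreover have "p ` V (K j) \<subseteq> V C"
    using lsubgraph_verts[OF subgraph_K[OF j]] quotient by (auto simp: quotient_by_def)
  ultimately show ?thesis
    using finite by (intro card_subset_eq) auto
qed

section \<open>Arcs of the layers and of the quotient\<close>

lemma H_arc_not_crossing: "i \<in> I \<Longrightarrow> a \<in> A (H i) \<Longrightarrow> p (tail (dig G) a) = p (head (dig G) a)"
  using lsubgraph_arc[OF subgraph_H] lsubgraph_verts[OF subgraph_H] p_eq_iff by blast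

text \<open>The ends are distinct because \<open>G\<close> has no loops, and \<open>p\<close>
  separates the vertices of \<open>K j\<close>.\<close>

lemma K_arc_crossing: "j \<in> J \<Longrightarrow> a \<in> A (K j) \<Longrightarrow> p (tail (dig G) a) \<noteq> p (head (dig G) a)"
  using lsubgraph_arc[OF subgraph_K, of j a] inj_on_p loopless
  by (auto simp: crossing_def inj_on_def)

lemma crossing_p: "crossing p G = (\<Union>j\<in>J. A (K j))"
proof
  show "crossing p G \<subseteq> (\<Union>j\<in>J. A (K j))"
    using H_arc_not_crossing unfolding crossing_def arcs_G by blast
  show "(\<Union>j\<in>J. A (K j)) \<subseteq> crossing p G"
    using K_arc_crossing unfolding crossing_def arcs_G by blast
qed

text \<open>Only arcs of the \<open>K j\<close> survive in \<open>C\<close>; this carries the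
  disjointness of labels over to the two contractions.\<close>

lemma L_subset: "L C \<subseteq> (\<Union>j\<in>J. L (K j))"
proof
  fix l assume "l \<in> L C"
  then obtain c where "c \<in> crossing p G" "l = lab G c"
    using quotient by (auto simp: L_def quotient_by_def)
  then obtain j where "j \<in> J" "c \<in> A (K j)" "l = lab (K j) c"
    using crossing_p lsubgraph_arc(4)[OF subgraph_K] by auto
  then show "l \<in> (\<Union>j\<in>J. L (K j))"
    by (auto simp: L_def)
qed

lemma inj_on_key_C: "inj_on (arc_key p G) (A C)"
proof -
  have "arc_key id C = arc_key p G"
    using quotient by (simp add: quotient_by_def arc_key_def fun_eq_iff)
  then show ?thesis
    using simple by (simp add: simple_def)
qed

text \<open>Simplicity passes from \<open>C\<close> to \<open>K j\<close> along the isomorphism, and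
  since \<open>p\<close> is injective on \<open>V (K j)\<close>, equal keys along \<open>p\<close>
  already mean equal ends.\<close>

lemma inj_on_key_K:
  assumes j: "j \<in> J"
  shows "inj_on (arc_key p G) (A (K j))"
proof (rule inj_onI)
  fix a b assume ab: "a \<in> A (K j)" "b \<in> A (K j)" "arc_key p G a = arc_key p G b"
  have Ca: "arc_key id C c = arc_key p G c" for c
    using quotient by (simp add: quotient_by_def arc_key_def)
  note K = lsubgraph_arc[OF subgraph_K[OF j]]
  have eq: "arc_key id (K j) a = arc_key id (K j) b"
    using ab K[OF ab(1)] K[OF ab(2)] inj_on_p[OF j] by (auto simp: arc_key_def inj_on_def)
  obtain \<phi> \<rho> where \<phi>: "bij_betw \<phi> (V C) (V (K j))" and \<rho>: "bij_betw \<rho> (A C) (A (K j))"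
    and hom: "\<And>c. c \<in> A C \<Longrightarrow> tail (dig (K j)) (\<rho> c) = \<phi> (tail (dig C) c) \<and>
              head (dig (K j)) (\<rho> c) = \<phi> (head (dig C) c) \<and> lab (K j) (\<rho> c) = lab C c"
    using iso[OF j] unfolding lgraph_iso_def by blast
  obtain c d where cd: "c \<in> A C" "d \<in> A C" "a = \<rho> c" "b = \<rho> d"
    using ab(1,2) bij_betw_imp_surj_on[OF \<rho>] by (metis imageE)
  \<comment> \<open>The map \<open>\<phi>\<close> is injective only on \<open>V C\<close>, so the
    ends of arcs of \<open>C\<close> are first located there.\<close>
  have ends: "tail (dig C) x \<in> V C" "head (dig C) x \<in> V C" if "x \<in> A C" for x
  proof -
    have "x \<in> crossing p G"
      using that quotient by (auto simp: quotient_by_def)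
    then obtain j' where "j' \<in> J" "x \<in> A (K j')"
      using crossing_p by auto
    then have "tail (dig G) x \<in> V G" "head (dig G) x \<in> V G"
      using lsubgraph_arc[OF subgraph_K] lsubgraph_verts[OF subgraph_K] by blast+
    then show "tail (dig C) x \<in> V C" "head (dig C) x \<in> V C"
      using quotient by (auto simp: quotient_by_def)
  qed
  have "\<phi> (tail (dig C) c) = \<phi> (tail (dig C) d)" "\<phi> (head (dig C) c) = \<phi> (head (dig C) d)"
    "lab C c = lab C d"
    using eq hom[OF cd(1)] hom[OF cd(2)] unfolding arc_key_def cd(3,4) by auto
  then have "arc_key id C c = arc_key id C d"
    using ends[OF cd(1)] ends[OF cd(2)] \<phi> by (auto simp: arc_key_def bij_betw_def inj_on_def)
  then show "a = b"
    using simple cd by (auto simp: simple_def inj_on_def)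
qed

text \<open>The isomorphism need not be compatible with \<open>p\<close>, but it preserves the
  number of arcs with each label pair. Keys with a fixed label pair lie in a finite set, where an
  inclusion between sets of equal size is an equality.\<close>

lemma image_key:
  assumes j: "j \<in> J"
  shows "arc_key p G ` A (K j) = arc_key p G ` A C"
proof
  have imC: "arc_key p G ` A C = arc_key p G ` crossing p G" and lab: "lab C = lab G"
    using quotient by (auto simp: quotient_by_def)
  show sub: "arc_key p G ` A (K j) \<subseteq> arc_key p G ` A C"
    unfolding imC crossing_p using j by auto
  obtain \<rho> where \<rho>: "bij_betw \<rho> (A C) (A (K j))"
    and lab\<rho>: "\<And>c. c \<in> A C \<Longrightarrow> lab (K j) (\<rho> c) = lab C c"
    using iso[OF j] unfolding lgraph_iso_def by blast
  note K = lsubgraph_arc[OF subgraph_K[OF j]]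
  show "arc_key p G ` A C \<subseteq> arc_key p G ` A (K j)"
  proof (rule image_subsetI)
    fix c assume c: "c \<in> A C"
    define S where "S = {x \<in> A C. lab G x = lab G c}"
    define T where "T = {x \<in> A (K j). lab G x = lab G c}"
    have T: "T = \<rho> ` S"
    proof -
      have "lab G (\<rho> x) = lab G x" if "x \<in> A C" for x
        using lab\<rho>[OF that] K(4)[OF bij_betwE[OF \<rho>, rule_format, OF that]] lab by simp
      moreover have "A (K j) = \<rho> ` A C"
        using \<rho> by (simp add: bij_betw_def)
      ultimately show ?thesis
        unfolding S_def T_def by auto
    qed
    have "inj_on \<rho> S"
      using \<rho> by (auto simp: bij_betw_def S_def inj_on_def)
    moreover have "inj_on (arc_key p G) T" "inj_on (arc_key p G) S"
      using inj_on_key_K[OF j] inj_on_key_C by (auto simp: T_def S_def inj_on_def)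
    \<comment> \<open>This equation holds for infinite sets too, whose \<open>card\<close> is 0;
      finiteness enters only when it is turned into an equality of sets.\<close>
    ultimately have card: "card (arc_key p G ` T) = card (arc_key p G ` S)"
      using T by (simp add: card_image)
    have "arc_key p G x \<in> V C \<times> V C \<times> {lab G c}" if "x \<in> S" for x
    proof -
      have "arc_key p G x \<in> arc_key p G ` crossing p G"
        using that imC by (auto simp: S_def)
      then obtain j' y where y: "j' \<in> J" "y \<in> A (K j')" "arc_key p G x = arc_key p G y"
        using crossing_p by auto
      have "p (tail (dig G) y) \<in> V C" "p (head (dig G) y) \<in> V C"
        using lsubgraph_arc[OF subgraph_K[OF y(1)] y(2)] image_p[OF y(1)] by auto
      then show ?thesis
        using y(3) that by (auto simp: arc_key_def S_def)
    qed
    then have "arc_key p G ` S \<subseteq> V C \<times> V C \<times> {lab G c}"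
      by blast
    then have "finite (arc_key p G ` S)"
      by (rule finite_subset) (simp add: finite)
    moreover have "arc_key p G ` T \<subseteq> arc_key p G ` S"
    proof (rule image_subsetI)
      fix x assume x: "x \<in> T"
      then obtain d where "d \<in> A C" "arc_key p G x = arc_key p G d"
        using sub by (auto simp: T_def)
      then show "arc_key p G x \<in> arc_key p G ` S"
        using x by (auto simp: S_def T_def arc_key_def)
    qed
    ultimately have "arc_key p G ` T = arc_key p G ` S"
      using card by (intro card_subset_eq)
    then show "arc_key p G c \<in> arc_key p G ` A (K j)"
      using c by (auto simp: S_def T_def)
  qed
qed

text \<open>The representative in \<open>C\<close> of the class of \<open>a\<close>; the arc
  \<open>a\<close> itself may have been discarded by merging.\<close>

definition proj_arc :: "'a \<Rightarrow> 'a" where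
  "proj_arc a = inv_into (A C) (arc_key p G) (arc_key p G a)"

lemma proj_arc:
  assumes "j \<in> J" "a \<in> A (K j)"
  shows "proj_arc a \<in> A C" "arc_key p G (proj_arc a) = arc_key p G a"
proof -
  have "arc_key p G a \<in> arc_key p G ` A C"
    using assms(2) image_key[OF assms(1)] by blast
  then show "proj_arc a \<in> A C" "arc_key p G (proj_arc a) = arc_key p G a"
    unfolding proj_arc_def by (rule inv_into_into, rule f_inv_into_f)
qed

lemma bij_betw_proj_arc: "j \<in> J \<Longrightarrow> bij_betw proj_arc (A (K j)) (A C)"
proof -
  assume j: "j \<in> J"
  have "bij_betw (arc_key p G) (A (K j)) (arc_key p G ` A C)"
    using inj_on_key_K[OF j] image_key[OF j] by (simp add: bij_betw_def)
  then show ?thesis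
    using bij_betw_trans[OF _ bij_betw_inv_into[OF inj_on_imp_bij_betw[OF inj_on_key_C]]]
    by (simp add: comp_def proj_arc_def[abs_def])
qed

end

subsection \<open>The product isomorphism\<close>

text \<open>Without shared labels no arc is synchronised. No vertex can be the first to be removed:
  some arc enters it in the product, and the tail of that arc would have to be removed
  earlier.\<close>

lemma vrsp_eq_cartesian_prod:
  assumes "L G \<inter> L H = {}"
  shows "vrsp G H = cartesian_prod G H"
proof -
  have *: "intermediate_prod G H = cartesian_prod G H"
    using assms by (fastforce simp: intermediate_prod_def cartesian_prod_def L_def)
  have "x \<notin> vrsp_removed G H" for x
  proof
    assume "x \<in> vrsp_removed G H"
    then show False
      by induction (auto simp: *)
  qed
  then have "vrsp_removed G H = {}"
    by auto
  then show ?thesis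
    by (simp add: vrsp_def * Let_def)
qed

lemma transversal_iso_cartesian_prod:
  assumes "transversal_layers G H I K J C p" and "transversal_layers G K J H I D q"
  shows "G \<cong> cartesian_prod C D"
proof -
  interpret P: transversal_layers G H I K J C p by fact
  interpret Q: transversal_layers G K J H I D q by fact
  define \<phi> where "\<phi> v = (p v, q v)" for v
  \<comment> \<open>An arc of \<open>K j\<close> stays in one fibre of \<open>q\<close>, so it
    becomes the copy of its projection over that fibre; arcs of \<open>H i\<close> are treated
    symmetrically.\<close>
  define \<rho> where "\<rho> a = (if a \<in> (\<Union>j\<in>J. A (K j)) then Arc1 (P.proj_arc a) (q (tail (dig G) a))
    else Arc2 (p (tail (dig G) a)) (Q.proj_arc a))" for a
  have inj_\<phi>: "inj_on \<phi> (V G)"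
  proof (rule inj_onI)
    fix u v assume uv: "u \<in> V G" "v \<in> V G" "\<phi> u = \<phi> v"
    then obtain j where j: "j \<in> J" "u \<in> V (K j)"
      using Q.verts_G by auto
    then have "v \<in> V (K j)"
      using uv Q.p_eq_iff by (auto simp: \<phi>_def)
    then show "u = v"
      using P.inj_on_p[OF j(1)] j uv(3) by (auto simp: \<phi>_def inj_on_def)
  qed
  have img_\<phi>: "\<phi> ` V G = V C \<times> V D"
  proof
    show "\<phi> ` V G \<subseteq> V C \<times> V D"
      using P.quotient Q.quotient by (auto simp: quotient_by_def \<phi>_def)
    \<comment> \<open>The second coordinate selects a layer \<open>K j\<close> as a fibre of
      \<open>q\<close>, and \<open>p\<close> maps this layer onto \<open>V C\<close>.\<close>
    show "V C \<times> V D \<subseteq> \<phi> ` V G"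
    proof
      fix x assume x: "x \<in> V C \<times> V D"
      then obtain w where w: "w \<in> V G" "snd x = q w"
        using Q.quotient by (auto simp: quotient_by_def)
      then obtain j where j: "j \<in> J" "w \<in> V (K j)"
        using Q.verts_G by auto
      obtain v where v: "v \<in> V (K j)" "fst x = p v"
        using P.image_p[OF j(1)] x by (metis imageE mem_Times_iff)
      have "v \<in> V G"
        using v j Q.verts_G by auto
      moreover have "\<phi> v = x"
        using w v Q.p_eq_iff[OF j \<open>v \<in> V G\<close>] by (simp add: \<phi>_def prod_eq_iff)
      ultimately show "x \<in> \<phi> ` V G"
        by auto
    qed
  qed
  have K\<rho>: "\<rho> a = Arc1 (P.proj_arc a) (q (tail (dig G) a))" if "j \<in> J" "a \<in> A (K j)" for j a
    using that by (auto simp: \<rho>_def)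
  have H\<rho>: "\<rho> a = Arc2 (p (tail (dig G) a)) (Q.proj_arc a)" if "i \<in> I" "a \<in> A (H i)" for i a
  proof -
    have "a \<notin> A (K j)" if "j \<in> J" for j
      using P.K_arc_crossing[OF that] P.H_arc_not_crossing[OF \<open>i \<in> I\<close> \<open>a \<in> A (H i)\<close>] by blast
    then show ?thesis
      by (simp add: \<rho>_def)
  qed
  have arc_cases: thesis
    if "a \<in> A G" "\<And>j. j \<in> J \<Longrightarrow> a \<in> A (K j) \<Longrightarrow> thesis" "\<And>i. i \<in> I \<Longrightarrow> a \<in> A (H i) \<Longrightarrow> thesis" for a thesis
    using that P.arcs_G by auto
  have K_tail: "tail (dig G) a \<in> V (K j) \<and> tail (dig G) a \<in> V G \<and> a \<in> A G"
    if "j \<in> J" "a \<in> A (K j)" for j a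
    using P.lsubgraph_arc(1,2)[OF P.subgraph_K that(2)] P.lsubgraph_verts[OF P.subgraph_K] that(1)
    by auto
  have H_tail: "tail (dig G) a \<in> V (H i) \<and> tail (dig G) a \<in> V G \<and> a \<in> A G"
    if "i \<in> I" "a \<in> A (H i)" for i a
    using P.lsubgraph_arc(1,2)[OF P.subgraph_H that(2)] P.lsubgraph_verts[OF P.subgraph_H] that(1)
    by auto
  \<comment> \<open>Equal \<open>q\<close>-values of the tails put both arcs into the same layer, on
    which the arc projection is injective.\<close>
  have P_inj: "a = b" if "j \<in> J" "a \<in> A (K j)" "j' \<in> J" "b \<in> A (K j')"
      "P.proj_arc a = P.proj_arc b" "q (tail (dig G) a) = q (tail (dig G) b)" for a b j j'
  proof -
    have "tail (dig G) b \<in> V (K j) \<inter> V (K j')"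
      using K_tail[OF that(1,2)] K_tail[OF that(3,4)] Q.p_eq_iff[OF that(1)] that(6) by blast
    then have "j = j'"
      using Q.disjoint that(1,3) unfolding disjoint_family_on_def by blast
    then show ?thesis
      using bij_betw_imp_inj_on[OF P.bij_betw_proj_arc[OF that(1)]] that(2,4,5) by (simp add: inj_on_def)
  qed
  have Q_inj: "a = b" if "i \<in> I" "a \<in> A (H i)" "i' \<in> I" "b \<in> A (H i')"
      "Q.proj_arc a = Q.proj_arc b" "p (tail (dig G) a) = p (tail (dig G) b)" for a b i i'
  proof -
    have "tail (dig G) b \<in> V (H i) \<inter> V (H i')"
      using H_tail[OF that(1,2)] H_tail[OF that(3,4)] P.p_eq_iff[OF that(1)] that(6) by blast
    then have "i = i'"
      using P.disjoint that(1,3) unfolding disjoint_family_on_def by blast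
    then show ?thesis
      using bij_betw_imp_inj_on[OF Q.bij_betw_proj_arc[OF that(1)]] that(2,4,5) by (simp add: inj_on_def)
  qed
  have inj_\<rho>: "inj_on \<rho> (A G)"
  proof (rule inj_onI)
    fix a b assume ab: "a \<in> A G" "b \<in> A G" "\<rho> a = \<rho> b"
    show "a = b"
      by (rule arc_cases[OF ab(1)]; rule arc_cases[OF ab(2)])
        (use ab(3) K\<rho> H\<rho> P_inj Q_inj in auto)
  qed
  have pq: "p ` V G = V C" "q ` V G = V D"
    using P.quotient Q.quotient by (auto simp: quotient_by_def)
  have \<rho>_in: "\<rho> a \<in> A (cartesian_prod C D)" if a: "a \<in> A G" for a
  proof (rule arc_cases[OF a])
    fix j assume "j \<in> J" "a \<in> A (K j)"
    moreover from this have "tail (dig G) a \<in> V G"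
      using K_tail by blast
    ultimately show ?thesis
      using K\<rho> P.proj_arc pq by (auto simp: cartesian_prod_def)
  next
    fix i assume "i \<in> I" "a \<in> A (H i)"
    moreover from this have "tail (dig G) a \<in> V G"
      using H_tail by blast
    ultimately show ?thesis
      using H\<rho> Q.proj_arc pq by (auto simp: cartesian_prod_def)
  qed
  \<comment> \<open>The vertex \<open>x\<close> determines a layer \<open>K j\<close>, whose arcs
    project onto \<open>A C\<close>.\<close>
  have Arc1_img: "Arc1 c x \<in> \<rho> ` A G" if cx: "c \<in> A C" "x \<in> V D" for c x
  proof -
    obtain w where "w \<in> V G" "x = q w"
      using cx(2) unfolding pq(2)[symmetric] by blast
    then obtain j where w: "j \<in> J" "w \<in> V (K j)" "x = q w"
      unfolding Q.verts_G by blast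
    obtain a where a: "a \<in> A (K j)" "P.proj_arc a = c"
      using cx(1) unfolding bij_betw_imp_surj_on[OF P.bij_betw_proj_arc[OF w(1)], symmetric] by blast
    note tail = K_tail[OF w(1) a(1)]
    have "q (tail (dig G) a) = x"
      using w(3) Q.p_eq_iff[OF w(1,2)] tail by metis
    then have "\<rho> a = Arc1 c x"
      using K\<rho>[OF w(1) a(1)] a(2) by simp
    then show ?thesis
      using tail by (metis image_eqI)
  qed
  have Arc2_img: "Arc2 x d \<in> \<rho> ` A G" if dx: "d \<in> A D" "x \<in> V C" for d x
  proof -
    obtain w where "w \<in> V G" "x = p w"
      using dx(2) unfolding pq(1)[symmetric] by blast
    then obtain i where w: "i \<in> I" "w \<in> V (H i)" "x = p w"
      unfolding P.verts_G by blast
    obtain a where a: "a \<in> A (H i)" "Q.proj_arc a = d"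
      using dx(1) unfolding bij_betw_imp_surj_on[OF Q.bij_betw_proj_arc[OF w(1)], symmetric] by blast
    note tail = H_tail[OF w(1) a(1)]
    have "p (tail (dig G) a) = x"
      using w(3) P.p_eq_iff[OF w(1,2)] tail by metis
    then have "\<rho> a = Arc2 x d"
      using H\<rho>[OF w(1) a(1)] a(2) by simp
    then show ?thesis
      using tail by (metis image_eqI)
  qed
  have img_\<rho>: "\<rho> ` A G = A (cartesian_prod C D)"
    using \<rho>_in Arc1_img Arc2_img by (auto simp: cartesian_prod_def)
  have hom: "prod_tail C D (\<rho> a) = \<phi> (tail (dig G) a) \<and> prod_head C D (\<rho> a) = \<phi> (head (dig G) a) \<and>
      prod_lab C D (\<rho> a) = lab G a" if a: "a \<in> A G" for a
  proof (rule arc_cases[OF a])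
    fix j assume j: "j \<in> J" "a \<in> A (K j)"
    have "q (tail (dig G) a) = q (head (dig G) a)"
      by (rule Q.H_arc_not_crossing[OF j])
    then show ?thesis
      using P.proj_arc[OF j] P.quotient
      by (auto simp: K\<rho>[OF j] \<phi>_def arc_key_def quotient_by_def)
  next
    fix i assume i: "i \<in> I" "a \<in> A (H i)"
    have "p (tail (dig G) a) = p (head (dig G) a)"
      by (rule P.H_arc_not_crossing[OF i])
    then show ?thesis
      using Q.proj_arc[OF i] Q.quotient
      by (auto simp: H\<rho>[OF i] \<phi>_def arc_key_def quotient_by_def)
  qed
  show ?thesis
    unfolding lgraph_iso_def
  proof (intro exI conjI ballI)
    show "bij_betw \<phi> (V G) (V (cartesian_prod C D))"
      using inj_\<phi> img_\<phi> by (simp add: bij_betw_def cartesian_prod_def)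
    show "bij_betw \<rho> (A G) (A (cartesian_prod C D))"
      using inj_\<rho> img_\<rho> by (simp add: bij_betw_def)
  qed (use hom in \<open>simp_all add: cartesian_prod_def\<close>)
qed

section \<open>Contraction along a partition into layers\<close>

lemma contract_layers_transversal:
  fixes G :: "('v, 'a, 's, 'w) lgraph" and H :: "nat \<Rightarrow> ('v, 'a, 's, 'w) lgraph"
  assumes graph: "lgraph G"
    and graph_H: "\<And>i. i \<in> {1..k} \<Longrightarrow> lgraph (H i)"
    and union: "is_union_of G (H ` {1..k} \<union> K ` J)"
    and disj: "disjoint_family_on (\<lambda>i. V (H i)) {1..k}"
    and contr: "\<And>j. j \<in> J \<Longrightarrow> contract_layers G H k \<cong> K j"
    and verts: "V G = (\<Union>i\<in>{1..k}. V (H i))"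
    and meet: "\<And>i j u v. \<lbrakk>i \<in> {1..k}; j \<in> J;
        u \<in> V (H i) \<inter> V (K j); v \<in> V (H i) \<inter> V (K j)\<rbrakk> \<Longrightarrow> u = v"
  shows "\<exists>p. transversal_layers G H {1..k} K J (contract_layers G H k) p"
proof -
  have loopless: "crossing id G = A G"
    using graph by (force simp: crossing_def lgraph_def acyclic_def arcs_ends_def arc_to_ends_def)
  have sub: "lsubgraph (H i) G" if "i \<in> {1..k}" for i
    using union that by (auto simp: is_union_of_def)
  have nonempty: "V S \<noteq> {}" if "lgraph S" for S :: "('v, 'a, 's, 'w) lgraph"
    using that unfolding lgraph_def connected_def strongly_connected_def by auto
  have layer: "V (H i) \<noteq> {} \<and> V (H i) \<subseteq> V G" if "i \<in> {1..k}" for i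
    using nonempty[OF graph_H[OF that]] that verts by auto
  \<comment> \<open>A connected graph has a vertex, so at least one contraction takes place and the
    result is simple.\<close>
  have "k > 0"
    using nonempty[OF graph] verts by (cases k) auto
  then obtain p where p: "quotient_by p G (contract_layers G H k)" "simple (contract_layers G H k)"
      "\<And>i v. i \<in> {1..k} \<Longrightarrow> v \<in> V (H i) \<Longrightarrow> p v = contract_vert (V (H i))"
    using contract_layers_quotient[OF loopless disj layer] by blast
  \<comment> \<open>The layers cover \<open>V G\<close>, so one vertex per layer is all that
    remains.\<close>
  have "V (contract_layers G H k) \<subseteq> (\<lambda>i. contract_vert (V (H i))) ` {1..k}"
    using p(1,3) verts by (auto simp: quotient_by_def)
  then have fin: "finite (V (contract_layers G H k))"
    by (rule finite_subset) simp
  have p_eq: "p u = p v \<longleftrightarrow> v \<in> V (H i)" if uv: "i \<in> {1..k}" "u \<in> V (H i)" "v \<in> V G" for i u v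
  proof
    assume "v \<in> V (H i)"
    then show "p u = p v"
      using p(3) uv by simp
  next
    assume eq: "p u = p v"
    obtain i' where i': "i' \<in> {1..k}" "v \<in> V (H i')"
      using uv(3) verts by auto
    \<comment> \<open>Each representative lies in its own layer, so by disjointness the value of
      \<open>p\<close> determines the layer.\<close>
    have "p u \<in> V (H i)" "p v \<in> V (H i')"
      using p(3) uv i' layer contract_vert_in by metis+
    then have "i = i'"
      using eq disj uv(1) i'(1) unfolding disjoint_family_on_def by (metis IntI empty_iff)
    then show "v \<in> V (H i)"
      using i' by simp
  qed
  have "transversal_layers G H {1..k} K J (contract_layers G H k) p"
  proof
    show "lsubgraph (K j) G" if "j \<in> J" for j
      using union that by (auto simp: is_union_of_def)
    show "A G = (\<Union>i\<in>{1..k}. A (H i)) \<union> (\<Union>j\<in>J. A (K j))"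
      using union by (simp add: is_union_of_def UN_Un)
  qed (fact loopless sub disj contr verts meet p(1,2) fin p_eq)+
  then show ?thesis
    by blast
qed

text \<open>The assumptions \<open>disj'\<close> and \<open>disj''\<close> make the layers the
  fibres of the two projections, and \<open>meet\<close> makes each projection injective on the
  layers of the other family.\<close>

theorem theorem1:
  fixes G :: "('v, 'a, 's, 'w) lgraph"
    and G' G'' :: "nat \<Rightarrow> ('v, 'a, 's, 'w) lgraph"
    and m n :: nat
  assumes graph_G: "lgraph G"
    and graph_G': "\<And>i. i \<in> {1..m} \<Longrightarrow> lgraph (G' i)"
    and graph_G'': "\<And>j. j \<in> {1..n} \<Longrightarrow> lgraph (G'' j)"
    and union: "is_union_of G (G' ` {1..m} \<union> G'' ` {1..n})"
    and iso': "\<And>i j. \<lbrakk>i \<in> {1..m}; j \<in> {1..m}\<rbrakk> \<Longrightarrow> G' i \<cong> G' j"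
    and iso'': "\<And>i j. \<lbrakk>i \<in> {1..n}; j \<in> {1..n}\<rbrakk> \<Longrightarrow> G'' i \<cong> G'' j"
    and disj': "disjoint_family_on (\<lambda>i. V (G' i)) {1..m}"
    and disj'': "disjoint_family_on (\<lambda>j. V (G'' j)) {1..n}"
    and contr': "\<And>j. j \<in> {1..n} \<Longrightarrow> contract_layers G G' m \<cong> G'' j"
    and contr'': "\<And>i. i \<in> {1..m} \<Longrightarrow> contract_layers G G'' n \<cong> G' i"
    and verts': "V G = (\<Union>i\<in>{1..m}. V (G' i))"
    and verts'': "V G = (\<Union>j\<in>{1..n}. V (G'' j))"
    and labels: "\<And>i j. \<lbrakk>i \<in> {1..m}; j \<in> {1..n}\<rbrakk> \<Longrightarrow> L (G' i) \<inter> L (G'' j) = {}"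
    and meet: "\<And>i j u v. \<lbrakk>i \<in> {1..m}; j \<in> {1..n};
        u \<in> V (G' i) \<inter> V (G'' j); v \<in> V (G' i) \<inter> V (G'' j)\<rbrakk> \<Longrightarrow> u = v"
  shows "G \<cong> vrsp (contract_layers G G' m) (contract_layers G G'' n)"
proof -
  let ?C = "contract_layers G G' m" and ?D = "contract_layers G G'' n"
  obtain p where p: "transversal_layers G G' {1..m} G'' {1..n} ?C p"
    using contract_layers_transversal[OF graph_G graph_G' union disj' contr' verts'] meet by blast
  have union': "is_union_of G (G'' ` {1..n} \<union> G' ` {1..m})"
    using union by (simp add: Un_commute)
  have meet': "\<And>i j u v. \<lbrakk>i \<in> {1..n}; j \<in> {1..m};
        u \<in> V (G'' i) \<inter> V (G' j); v \<in> V (G'' i) \<inter> V (G' j)\<rbrakk> \<Longrightarrow> u = v"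
    using meet by blast
  obtain q where q: "transversal_layers G G'' {1..n} G' {1..m} ?D q"
    using contract_layers_transversal[OF graph_G graph_G'' union' disj'' contr'' verts''] meet'
    by blast
  \<comment> \<open>Contracting one family leaves only arcs of the other: the labels of
    \<open>?C\<close> come from the \<open>G'' j\<close>, those of \<open>?D\<close> from the
    \<open>G' i\<close>.\<close>
  have "L ?C \<inter> L ?D = {}"
  proof -
    have "(\<Union>j\<in>{1..n}. L (G'' j)) \<inter> (\<Union>i\<in>{1..m}. L (G' i)) = {}"
      using labels by (simp add: Int_UN_distrib2 Int_commute)
    then show ?thesis
      using transversal_layers.L_subset[OF p] transversal_layers.L_subset[OF q] by (meson disjoint_iff subsetD)
  qed
  then show ?thesis
    using transversal_iso_cartesian_prod[OF p q] by (simp add: vrsp_eq_cartesian_prod)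
qed

end
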